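(* Let $G$ be a bipartite graph with bipartition $\{B,R\}$, where $m:=|B|\ge 1$, $n:=|R|\ge1$ and $m\le n$, and let $k$ be an integer with $1\le k\le m+n-1$. Let $\mathcal R$ (resp. $\mathcal B$) be the set of $k$-subsets $A$ of $V(G)$ with $|R\cap A|$ odd (resp. even). Suppose $G$ has either a perfect matching or an almost perfect matching. If $G'$ is a bipartite graph on the same vertex set with the same bipartition $\{R,B\}$ that contains $G$ as a subgraph, then $\beta(F_k(G'))=\max\{|\mathcal R|,|\mathcal B|\}$.
   Context: For a simple finite graph $G$ of order $N$ and an integer $1\le k\le N-1$, the $k$-token graph $F_k(G)$ is the graph whose vertices are all $k$-element subsets of $V(G)$, two such subsets being adjacent iff their symmetric difference is an edge of $G$. $\beta$ denotes the independence number. A perfect matching covers all vertices; an almost perfect matching is a matching covering all but exactly one vertex. *)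

theory Defs
  imports Main
begin

datatype 'a ugraph = UGraph (verts: "'a set") (edges: "'a set set")

definition simple_graph :: "'a ugraph \<Rightarrow> bool" where
  "simple_graph G \<longleftrightarrow>
     finite (verts G) \<and> (\<forall>e\<in>edges G. e \<subseteq> verts G \<and> card e = 2)"

definition bipartition :: "'a ugraph \<Rightarrow> 'a set \<Rightarrow> 'a set \<Rightarrow> bool" where
  "bipartition G B R \<longleftrightarrow>
     B \<inter> R = {} \<and> B \<union> R = verts G \<and> (\<forall>e\<in>edges G. \<exists>b\<in>B. \<exists>r\<in>R. e = {b, r})"

definition subgraph :: "'a ugraph \<Rightarrow> 'a ugraph \<Rightarrow> bool" where
  "subgraph H G \<longleftrightarrow> verts H \<subseteq> verts G \<and> edges H \<subseteq> edges G"

definition is_matching :: "'a ugraph \<Rightarrow> 'a set set \<Rightarrow> bool" where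
  "is_matching G M \<longleftrightarrow> M \<subseteq> edges G \<and> (\<forall>e\<in>M. \<forall>f\<in>M. e \<noteq> f \<longrightarrow> e \<inter> f = {})"

definition has_perfect_matching :: "'a ugraph \<Rightarrow> bool" where
  "has_perfect_matching G \<longleftrightarrow> (\<exists>M. is_matching G M \<and> \<Union>M = verts G)"

definition has_almost_perfect_matching :: "'a ugraph \<Rightarrow> bool" where
  "has_almost_perfect_matching G \<longleftrightarrow>
     (\<exists>M. is_matching G M \<and> (\<exists>v\<in>verts G. \<Union>M = verts G - {v}))"

(* The case u = v is vacuous in a simple graph, where {u, u} is never an edge. *)
definition independent_set :: "'a ugraph \<Rightarrow> 'a set \<Rightarrow> bool" where
  "independent_set G S \<longleftrightarrow> S \<subseteq> verts G \<and> (\<forall>u\<in>S. \<forall>v\<in>S. {u, v} \<notin> edges G)"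

definition independence_number :: "'a ugraph \<Rightarrow> nat" where
  "independence_number G = Max {card S | S. independent_set G S}"

definition token_graph :: "nat \<Rightarrow> 'a ugraph \<Rightarrow> 'a set ugraph" where
  "token_graph k G =
     UGraph {A. A \<subseteq> verts G \<and> card A = k}
       {{A, A'} | A A'. A \<subseteq> verts G \<and> card A = k \<and> A' \<subseteq> verts G \<and> card A' = k \<and>
          sym_diff A A' \<in> edges G}"

lemma simple_graph_token_graph:
  assumes "simple_graph G"
  shows "simple_graph (token_graph k G)"
proof -
  have "finite {A. A \<subseteq> verts G \<and> card A = k}"
    using assms by (auto simp: simple_graph_def)
  moreover have "A \<noteq> A'" if "sym_diff A A' \<in> edges G" for A A'
    using that assms by (auto simp: simple_graph_def)
  ultimately show ?thesis
    by (fastforce simp: simple_graph_def token_graph_def)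
qed

end

theory Submission
  imports Defs
begin

text \<open>
  Every edge of the token graph changes the parity of \<open>card (R \<inter> A)\<close>, so both parity classes
  are independent. For the upper bound, let \<open>M\<close> be the given matching of \<open>G\<close>. If some edge of \<open>M\<close>
  carries exactly one token of \<open>A\<close>, slide the token along a chosen such edge; the choice depends
  only on the set of such edges, which sliding preserves, so this is an involution that exchanges
  the parity classes and maps each \<open>A\<close> to a neighbour. If no such edge exists, then \<open>A\<close> is a union
  of \<open>k div 2\<close> edges of \<open>M\<close>, plus the uncovered vertex if \<open>k\<close> is odd; hence all these exceptional
  sets lie in one parity class. Sliding maps an independent set injectively into that class.
\<close>

lemma even_card_sym_diff:
  assumes "finite X" "finite Y"
  shows "even (card (sym_diff X Y)) \<longleftrightarrow> (even (card X) \<longleftrightarrow> even (card Y))"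
proof -
  have "card (sym_diff X Y) = card (X - Y) + card (Y - X)"
    using assms by (intro card_Un_disjoint) auto
  moreover have "card X = card (X \<inter> Y) + card (X - Y)" "card Y = card (X \<inter> Y) + card (Y - X)"
    using assms card_Int_Diff[of X Y] card_Int_Diff[of Y X] by (simp_all add: Int_commute)
  ultimately show ?thesis by auto
qed

text \<open>Taking the symmetric difference with a half filled edge moves one token to the free end,
  so a slide keeps the number of tokens.\<close>

lemma card_sym_diff_eq:
  assumes "finite A" "card e = 2" "card (A \<inter> e) = 1"
  shows "card (sym_diff A e) = card A"
proof -
  have fe: "finite e" using assms(2) by (metis card.infinite zero_neq_numeral)
  have "card (sym_diff A e) = card (A - e) + card (e - A)"
    using assms(1) fe by (intro card_Un_disjoint) auto
  moreover have "card A = 1 + card (A - e)" "2 = 1 + card (e - A)"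
    using assms fe card_Int_Diff[of A e] card_Int_Diff[of e A] by (simp_all add: Int_commute)
  ultimately show ?thesis by simp
qed

lemma bipartition_edgeE:
  assumes "bipartition G B R" "e \<in> edges G"
  obtains b r where "b \<in> B" "r \<in> R" "b \<notin> R" "e = {b, r}"
proof -
  obtain b r where br: "b \<in> B" "r \<in> R" "e = {b, r}"
    using assms unfolding bipartition_def by (elim conjE) (drule (1) bspec, elim bexE)
  moreover have "b \<notin> R" using assms(1) br(1) unfolding bipartition_def by blast
  ultimately show thesis using that by simp
qed

text \<open>An edge of \<open>G\<close> has exactly one end in \<open>R\<close>, so the red parts of
  \<open>A\<close> and \<open>A'\<close> differ in a single vertex.\<close>

lemma parity_flips_along_edge:
  assumes "bipartition G B R" "finite A" "finite A'" "sym_diff A A' \<in> edges G"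
  shows "odd (card (R \<inter> A)) \<longleftrightarrow> even (card (R \<inter> A'))"
proof -
  obtain b r where "r \<in> R" "b \<notin> R" and e: "sym_diff A A' = {b, r}"
    using bipartition_edgeE[OF assms(1,4)] by metis
  have "sym_diff (R \<inter> A) (R \<inter> A') = R \<inter> sym_diff A A'" by blast
  also have "\<dots> = {r}" using e \<open>r \<in> R\<close> \<open>b \<notin> R\<close> by auto
  finally have "odd (card (sym_diff (R \<inter> A) (R \<inter> A')))" by simp
  then show ?thesis using even_card_sym_diff[of "R \<inter> A" "R \<inter> A'"] assms(2,3) by simp
qed

lemma independent_parity_class:
  assumes "simple_graph G" "bipartition G B R"
  shows "independent_set (token_graph k G)
    {A. A \<subseteq> verts G \<and> card A = k \<and> (odd (card (R \<inter> A)) \<longleftrightarrow> p)}"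
proof -
  have fin: "finite A" if "A \<subseteq> verts G" for A
    using that assms(1) finite_subset unfolding simple_graph_def by blast
  have "{A, A'} \<notin> edges (token_graph k G)"
    if "A \<subseteq> verts G" "A' \<subseteq> verts G" "odd (card (R \<inter> A)) \<longleftrightarrow> p" "odd (card (R \<inter> A')) \<longleftrightarrow> p" for A A'
  proof
    assume "{A, A'} \<in> edges (token_graph k G)"
    then have "sym_diff A A' \<in> edges G"
      by (auto simp: token_graph_def doubleton_eq_iff Un_commute)
    then show False
      using parity_flips_along_edge[OF assms(2) fin[OF that(1)] fin[OF that(2)]] that(3,4) by blast
  qed
  then show ?thesis by (auto simp: independent_set_def token_graph_def)
qed

definition half_filled :: "'a set set \<Rightarrow> 'a set \<Rightarrow> 'a set set" where
  "half_filled M A = {e \<in> M. card (A \<inter> e) = 1}"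

text \<open>\<open>SOME\<close> sees \<open>A\<close> only through \<open>half_filled M A\<close>,
  so sets with the same half filled edges slide along the same edge. If there are none, the edge is
  arbitrary; hence the nonemptiness assumptions below.\<close>

definition slide :: "'a set set \<Rightarrow> 'a set \<Rightarrow> 'a set" where
  "slide M A = sym_diff A (SOME e. e \<in> half_filled M A)"

text \<open>On \<open>e\<close> the token and the free end change places, which leaves one token
  there; every other edge of \<open>M\<close> is disjoint from \<open>e\<close> and keeps its
  tokens.\<close>

lemma half_filled_sym_diff:
  assumes "\<forall>e\<in>M. card e = 2" "\<forall>e\<in>M. \<forall>f\<in>M. e \<noteq> f \<longrightarrow> e \<inter> f = {}" "e \<in> half_filled M A"
  shows "half_filled M (sym_diff A e) = half_filled M A"
proof -
  have e: "e \<in> M" "card (A \<inter> e) = 1" using assms(3) by (auto simp: half_filled_def)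
  have "card (sym_diff A e \<inter> f) = 1 \<longleftrightarrow> card (A \<inter> f) = 1" if "f \<in> M" for f
  proof (cases "f = e")
    case True
    have "sym_diff A e \<inter> e = e - A" by blast
    moreover have "card e = card (e \<inter> A) + card (e - A)"
      using assms(1) e(1) by (metis card_Int_Diff card.infinite zero_neq_numeral)
    ultimately show ?thesis using True e assms(1) by (auto simp: Int_commute)
  next
    case False
    then have "sym_diff A e \<inter> f = A \<inter> f" using assms(2) e(1) that by blast
    then show ?thesis by simp
  qed
  then show ?thesis unfolding half_filled_def by blast
qed

lemma slide_slide:
  assumes "\<forall>e\<in>M. card e = 2" "\<forall>e\<in>M. \<forall>f\<in>M. e \<noteq> f \<longrightarrow> e \<inter> f = {}" "half_filled M A \<noteq> {}"
  shows "slide M (slide M A) = A"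
proof -
  define e where "e = (SOME e. e \<in> half_filled M A)"
  have "e \<in> half_filled M A" using assms(3) by (simp add: e_def some_in_eq)
  then have "slide M (slide M A) = sym_diff (sym_diff A e) e"
    using half_filled_sym_diff[OF assms(1,2)] by (simp add: slide_def e_def)
  then show ?thesis by blast
qed

lemma sym_diff_slide_half_filled:
  assumes "half_filled M A \<noteq> {}"
  shows "sym_diff A (slide M A) \<in> half_filled M A"
proof -
  have "sym_diff A (slide M A) = (SOME e. e \<in> half_filled M A)" unfolding slide_def by blast
  then show ?thesis using assms by (simp add: some_in_eq)
qed

text \<open>Each edge of \<open>M\<close> holds two tokens or none, and exactly one of its ends is
  red. The remaining term is 1 precisely when the uncovered vertex carries a token and is red. The
  right-hand side depends on \<open>A\<close> only through \<open>card A\<close>, which puts all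
  such \<open>k\<close>-sets into one parity class.\<close>

lemma card_red_without_half_filled:
  assumes "simple_graph G" "bipartition G B R" "is_matching G M" "A \<subseteq> verts G"
    and "half_filled M A = {}" "card (verts G - \<Union>M) \<le> 1"
  shows "card (R \<inter> A) = card A div 2 + (if odd (card A) then card (R - \<Union>M) else 0)"
proof -
  let ?U = "verts G - \<Union>M"
  have finV: "finite (verts G)" using assms(1) by (simp add: simple_graph_def)
  have MG: "M \<subseteq> edges G" and disj: "\<And>e f. e \<in> M \<Longrightarrow> f \<in> M \<Longrightarrow> e \<noteq> f \<Longrightarrow> e \<inter> f = {}"
    using assms(3) by (auto simp: is_matching_def)
  have MV: "\<And>e. e \<in> M \<Longrightarrow> e \<subseteq> verts G" using MG assms(1) by (auto simp: simple_graph_def)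
  have finM: "finite M" using MV finV by (meson PowI finite_Pow_iff finite_subset subsetI)
  have RV: "R \<subseteq> verts G" using assms(2) by (auto simp: bipartition_def)
  have finA: "finite A" using assms(4) finV finite_subset by blast
  have fin: "\<And>e. e \<in> M \<Longrightarrow> finite e" using MV finV finite_subset by blast
  \<comment> \<open>Kept general in \<open>X\<close> because \<open>double\<close> applies it to
    both \<open>A\<close> and \<open>R \<inter> A\<close>.\<close>
  have cov: "card (X \<inter> \<Union>M) = (\<Sum>e\<in>M. card (X \<inter> e))" for X
  proof -
    have "card (\<Union>e\<in>M. X \<inter> e) = (\<Sum>e\<in>M. card (X \<inter> e))"
    proof (intro card_UN_disjoint finM ballI impI)
      show "X \<inter> e \<inter> (X \<inter> f) = {}" if "e \<in> M" "f \<in> M" "e \<noteq> f" for e f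
        using disj[OF that] by blast
    qed (use fin in auto)
    moreover have "(\<Union>e\<in>M. X \<inter> e) = X \<inter> \<Union>M" by blast
    ultimately show ?thesis by simp
  qed
  have "card (A \<inter> e) = 2 * card ((R \<inter> A) \<inter> e)" if "e \<in> M" for e
  proof -
    have "e \<in> edges G" using that MG by blast
    then obtain b r where "r \<in> R" "b \<notin> R" and e: "e = {b, r}"
      using bipartition_edgeE[OF assms(2)] by metis
    then have "b \<noteq> r" by metis
    have "card (A \<inter> e) \<noteq> 1" using that assms(5) by (auto simp: half_filled_def)
    then have "b \<in> A \<longleftrightarrow> r \<in> A" using e by (auto simp: Int_insert_right split: if_splits)
    then show ?thesis using e \<open>b \<notin> R\<close> \<open>b \<noteq> r\<close> \<open>r \<in> R\<close>
      by (cases "r \<in> A") (auto simp: Int_insert_right)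
  qed
  then have double: "card (A \<inter> \<Union>M) = 2 * card ((R \<inter> A) \<inter> \<Union>M)"
    unfolding cov by (simp add: sum_distrib_left)
  have cA: "card A = card (A \<inter> \<Union>M) + card (A \<inter> ?U)"
  proof -
    have "A - \<Union>M = A \<inter> ?U" using assms(4) by blast
    then show ?thesis using card_Int_Diff[OF finA, of "\<Union>M"] by simp
  qed
  have cR: "card (R \<inter> A) = card ((R \<inter> A) \<inter> \<Union>M) + card (R \<inter> (A \<inter> ?U))"
  proof -
    have "R \<inter> A - \<Union>M = R \<inter> (A \<inter> ?U)" using assms(4) by blast
    then show ?thesis using card_Int_Diff[of "R \<inter> A" "\<Union>M"] finA by simp
  qed
  have "A \<inter> ?U = {} \<or> A \<inter> ?U = ?U \<and> card ?U = 1"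
  proof -
    have "card ?U = 0 \<or> card ?U = 1" using assms(6) by linarith
    then consider "?U = {}" | v where "?U = {v}"
      using finV by (metis card_1_singletonE card_0_eq finite_Diff)
    then show ?thesis
    proof cases
      case 1 then show ?thesis by (metis Int_empty_right)
    next
      case 2
      then show ?thesis unfolding 2 by (cases "v \<in> A") simp_all
    qed
  qed
  \<comment> \<open>By \<open>double\<close> the covered part of \<open>A\<close> has even size, so
    the two cases are exactly \<open>card A\<close> even and \<open>card A\<close> odd.\<close>
  then show ?thesis
  proof
    assume "A \<inter> ?U = {}"
    then show ?thesis using cA cR double by simp
  next
    assume U: "A \<inter> ?U = ?U \<and> card ?U = 1"
    moreover have "R \<inter> ?U = R - \<Union>M" using RV by blast
    ultimately show ?thesis using cA cR double by simp
  qed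
qed

lemma independent_set_card_le_parity_class:
  assumes "simple_graph G" "bipartition G B R" "is_matching G M" "card (verts G - \<Union>M) \<le> 1"
    and "independent_set (token_graph k G) S"
  shows "\<exists>p. card S \<le> card {A. A \<subseteq> verts G \<and> card A = k \<and> (odd (card (R \<inter> A)) \<longleftrightarrow> p)}"
proof -
  \<comment> \<open>The parity forced on \<open>k\<close>-sets without half filled edges; every
    \<open>k\<close>-set of the other parity can therefore slide.\<close>
  define p where "p \<longleftrightarrow> odd (k div 2 + (if odd k then card (R - \<Union>M) else 0))"
  let ?P = "{A. A \<subseteq> verts G \<and> card A = k \<and> (odd (card (R \<inter> A)) \<longleftrightarrow> p)}"
  have finV: "finite (verts G)" using assms(1) by (simp add: simple_graph_def)
  have fin: "finite A" if "A \<subseteq> verts G" for A using that finV finite_subset by blast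
  have ME: "M \<subseteq> edges G" and disj: "\<forall>e\<in>M. \<forall>f\<in>M. e \<noteq> f \<longrightarrow> e \<inter> f = {}"
    using assms(3) by (auto simp: is_matching_def)
  have two: "\<forall>e\<in>M. card e = 2" using ME assms(1) by (auto simp: simple_graph_def)
  have S: "A \<subseteq> verts G \<and> card A = k" if "A \<in> S" for A
    using assms(5) that by (auto simp: independent_set_def token_graph_def)
  have ind: "sym_diff A A' \<notin> edges G" if "A \<in> S" "A' \<in> S" for A A'
  proof
    assume "sym_diff A A' \<in> edges G"
    then have "{A, A'} \<in> edges (token_graph k G)"
      using S[OF that(1)] S[OF that(2)] by (auto simp: token_graph_def)
    then show False using assms(5) that by (auto simp: independent_set_def)
  qed
  define f where "f A = (if odd (card (R \<inter> A)) \<longleftrightarrow> p then A else slide M A)" for A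
  have wrong: "half_filled M A \<noteq> {}" if "A \<in> S" "odd (card (R \<inter> A)) \<noteq> p" for A
    using card_red_without_half_filled[OF assms(1-3) _ _ assms(4), of A] S[OF that(1)] that(2)
    unfolding p_def by auto
  have edge: "sym_diff A (slide M A) \<in> edges G" if "half_filled M A \<noteq> {}" for A
    using sym_diff_slide_half_filled[OF that] ME by (auto simp: half_filled_def)
  have "f ` S \<subseteq> ?P"
  proof
    fix X assume "X \<in> f ` S"
    then obtain A where A: "A \<in> S" "X = f A" by blast
    show "X \<in> ?P"
    proof (cases "odd (card (R \<inter> A)) \<longleftrightarrow> p")
      case True
      then show ?thesis using A S[OF A(1)] by (simp add: f_def)
    next
      case False
      note ne = wrong[OF A(1) False]
      define e where "e = (SOME e. e \<in> half_filled M A)"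
      have "e \<in> half_filled M A" using ne by (simp add: e_def some_in_eq)
      then have e: "e \<in> M" "card (A \<inter> e) = 1" by (auto simp: half_filled_def)
      have X: "X = slide M A" "X = sym_diff A e"
        using A(2) False by (auto simp: f_def slide_def e_def)
      have "e \<subseteq> verts G" using e(1) ME assms(1) by (auto simp: simple_graph_def)
      then have XV: "X \<subseteq> verts G" using X(2) S[OF A(1)] by blast
      moreover have "card X = k"
        using X(2) card_sym_diff_eq[OF fin _ e(2)] S[OF A(1)] two e(1) by simp
      moreover have "odd (card (R \<inter> X)) \<longleftrightarrow> p"
        using parity_flips_along_edge[OF assms(2) fin fin edge[OF ne]] S[OF A(1)] XV X(1) False
        by auto
      ultimately show ?thesis by simp
    qed
  qed
  moreover have "inj_on f S"
  proof -
    \<comment> \<open>A slid set is a neighbour of a member of \<open>S\<close>, so it cannot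
      collide with a set that \<open>f\<close> leaves fixed; two slid sets are told apart by
      \<open>slide_slide\<close>.\<close>
    have no: "slide M A' \<notin> S" if "A' \<in> S" "odd (card (R \<inter> A')) \<noteq> p" for A'
      using ind[OF that(1)] edge[OF wrong[OF that]] by blast
    show ?thesis
    proof (rule inj_onI)
      fix A A' assume "A \<in> S" "A' \<in> S" "f A = f A'"
      then show "A = A'"
        using no[of A] no[of A'] slide_slide[OF two disj wrong, of A]
          slide_slide[OF two disj wrong, of A']
        by (auto simp: f_def split: if_splits)
    qed
  qed
  moreover have "finite ?P"
    by (rule finite_subset[of _ "Pow (verts G)"]) (use finV in auto)
  ultimately have "card S \<le> card ?P" by (simp add: card_inj_on_le)
  then show ?thesis by blast
qed

theorem theorem3p10:
  fixes G G' :: "'a ugraph" and B R :: "'a set" and m n k :: nat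
  assumes "simple_graph G" and "bipartition G B R"
    and "m = card B" and "n = card R"
    and "1 \<le> m" and "1 \<le> n" and "m \<le> n"
    and "1 \<le> k" and "k \<le> m + n - 1"
    and "has_perfect_matching G \<or> has_almost_perfect_matching G"
    and "simple_graph G'" and "verts G' = verts G" and "bipartition G' B R"
    and "subgraph G G'"
  shows "independence_number (token_graph k G') =
    max (card {A. A \<subseteq> verts G \<and> card A = k \<and> odd (card (R \<inter> A))})
        (card {A. A \<subseteq> verts G \<and> card A = k \<and> even (card (R \<inter> A))})"
proof -
  define P where "P p = {A. A \<subseteq> verts G' \<and> card A = k \<and> (odd (card (R \<inter> A)) \<longleftrightarrow> p)}" for p
  obtain M where M: "is_matching G M" "card (verts G - \<Union>M) \<le> 1"
  proof -
    have "\<exists>M. is_matching G M \<and> card (verts G - \<Union>M) \<le> 1"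
      using assms(10)
    proof
      assume "has_perfect_matching G"
      then show ?thesis unfolding has_perfect_matching_def by force
    next
      assume "has_almost_perfect_matching G"
      then obtain M v where "is_matching G M" "v \<in> verts G" "\<Union>M = verts G - {v}"
        unfolding has_almost_perfect_matching_def by blast
      moreover from this have "verts G - \<Union>M = {v}" by auto
      ultimately show ?thesis by (intro exI[of _ M]) simp
    qed
    then show thesis using that by blast
  qed
  \<comment> \<open>The matching survives in the larger graph on the same vertices, so the whole
    argument runs in \<open>G'\<close>.\<close>
  have M': "is_matching G' M" "card (verts G' - \<Union>M) \<le> 1"
    using M assms(12,14) by (auto simp: is_matching_def subgraph_def)
  let ?C = "{card S | S. independent_set (token_graph k G') S}"
  let ?m = "max (card (P True)) (card (P False))"
  have ind: "independent_set (token_graph k G') (P p)" for p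
    unfolding P_def by (rule independent_parity_class[OF assms(11,13)])
  have upper: "c \<le> ?m" if "c \<in> ?C" for c
  proof -
    from that obtain S where S: "c = card S" "independent_set (token_graph k G') S" by blast
    obtain p where "card S \<le> card (P p)"
      using independent_set_card_le_parity_class[OF assms(11,13) M' S(2)] unfolding P_def by blast
    then show ?thesis using S(1) by (cases p) auto
  qed
  have "Max ?C = ?m"
  proof (rule Max_eqI)
    \<comment> \<open>A set of naturals bounded by \<open>?m\<close> is finite, so
      \<open>upper\<close> suffices here too.\<close>
    show "finite ?C" using upper by (meson finite_nat_set_iff_bounded_le)
    show "?m \<in> ?C" unfolding max_def using ind by auto
  qed (use upper in blast)
  then show ?thesis unfolding independence_number_def P_def assms(12) by simp
qed

end
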